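(* Let $X$ be a random element of a sample space $\mathcal{X}$, let $G$ be a finite group (under composition) of transformations $g:\mathcal{X}\to\mathcal{X}$, and let $T:\mathcal{X}\to\mathbb{R}$ be a test statistic. Let $w\ge 1$ be an integer, $g_1=\mathrm{id}$, and let $g_2,\dots,g_w$ be random elements of $G$, independent of $X$, drawn uniformly either with replacement from $G$, or without replacement from $G\setminus\{\mathrm{id}\}$ (in which case $w\le\#G$). Write $G'=(g_1,\dots,g_w)$ and let $T^{(1)}(X,G')\le\dots\le T^{(w)}(X,G')$ be the sorted values $T(g_jX)$, $1\le j\le w$. Let $\alpha\in[0,1)$, $k'=\lceil(1-\alpha)w\rceil$, and $$M^+(X,G')=\#\{1\le j\le w: T(g_jX)>T^{(k')}(X,G')\},$$ $$M^0(X,G')=\#\{1\le j\le w: T(g_jX)=T^{(k')}(X,G')\},$$ $$a=a(X,G')=\frac{w\alpha-M^+(X,G')}{M^0(X,G')}.$$ Consider the randomized test that rejects $H_{\mathrm p}$ if $T(X)>T^{(k')}(X,G')$, rejects with (conditional) probability $a(X,G')$ if $T(X)=T^{(k')}(X,G')$, and does not reject otherwise. If $H_{\mathrm p}$ holds, i.e. the joint distribution of $(T(bX))_{b\in G}$ equals that of $(T(bgX))_{b\in G}$ for every $g\in G$, then the rejection probability is exactly $\alpha$; that is, $$\mathbb{E}\big[\mathbf{1}_{\{T(X)>T^{(k')}(X,G')\}}+a(X,G')\,\mathbf{1}_{\{T(X)=T^{(k')}(X,G')\}}\big]=\alpha.$$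
   Context: $gX$ denotes $g(X)$; $\#S$ is the cardinality of $S$. All maps are assumed measurable, so that each $T(gX)$ is a random variable. $\mathrm{id}$ is the identity map $x\mapsto x$, which is the identity element of $G$. The sorted values $T(g_jX)$ are counted with multiplicity. Drawing with replacement from a finite set means independent uniform draws from it; drawing $g_2,\dots,g_w$ without replacement means that $(g_2,\dots,g_w)$ is uniformly distributed over ordered tuples of $w-1$ distinct elements of the set. *)

theory Defs
  imports "HOL-Probability.Probability" "HOL-Algebra.Group"
begin

text \<open>Transformations of the sample space \<open>A\<close> are represented by extensional functions
  (with value \<open>undefined\<close> outside \<open>A\<close>), so that distinct elements of \<open>G\<close> are distinct maps on \<open>A\<close>.\<close>

definition composition_monoid :: "'x set \<Rightarrow> ('x \<Rightarrow> 'x) set \<Rightarrow> ('x \<Rightarrow> 'x) monoid" where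
  "composition_monoid A G = \<lparr>carrier = G, mult = compose A, one = (\<lambda>x\<in>A. x)\<rparr>"

definition transformation_group :: "'x set \<Rightarrow> ('x \<Rightarrow> 'x) set \<Rightarrow> bool" where
  "transformation_group A G \<longleftrightarrow> G \<subseteq> A \<rightarrow>\<^sub>E A \<and> group (composition_monoid A G)"

text \<open>The library's \<open>indep_var\<close> needs both random elements to have values of the same type;
  this is its characterisation \<open>indep_var_eq\<close> with two value types.\<close>

definition indep_elements ::
  "'o measure \<Rightarrow> 'x measure \<Rightarrow> ('o \<Rightarrow> 'x) \<Rightarrow> 'y measure \<Rightarrow> ('o \<Rightarrow> 'y) \<Rightarrow> bool" where
  "indep_elements M S X N Y \<longleftrightarrow> X \<in> M \<rightarrow>\<^sub>M S \<and> Y \<in> M \<rightarrow>\<^sub>M N \<and>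
     prob_space.indep_set M (sets (vimage_algebra (space M) X S)) (sets (vimage_algebra (space M) Y N))"

definition drawn_tuple :: "nat \<Rightarrow> (nat \<Rightarrow> 'o \<Rightarrow> 'g) \<Rightarrow> 'o \<Rightarrow> nat \<Rightarrow> 'g" where
  "drawn_tuple w g \<omega> = (\<lambda>j\<in>{2..w}. g j \<omega>)"

definition tuple_space :: "nat \<Rightarrow> 'g set \<Rightarrow> (nat \<Rightarrow> 'g) measure" where
  "tuple_space w G = count_space ({2..w} \<rightarrow>\<^sub>E G)"

definition drawn_with_replacement ::
  "'o measure \<Rightarrow> 'g set \<Rightarrow> nat \<Rightarrow> (nat \<Rightarrow> 'o \<Rightarrow> 'g) \<Rightarrow> bool" where
  "drawn_with_replacement M G w g \<longleftrightarrow>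
     prob_space.indep_vars M (\<lambda>_. count_space G) g {2..w} \<and>
     (\<forall>j\<in>{2..w}. distr M (count_space G) (g j) = uniform_count_measure G)"

definition drawn_without_replacement ::
  "'o measure \<Rightarrow> 'g set \<Rightarrow> 'g \<Rightarrow> nat \<Rightarrow> (nat \<Rightarrow> 'o \<Rightarrow> 'g) \<Rightarrow> bool" where
  "drawn_without_replacement M G e w g \<longleftrightarrow>
     w \<le> card G \<and> drawn_tuple w g \<in> M \<rightarrow>\<^sub>M tuple_space w G \<and>
     distr M (tuple_space w G) (drawn_tuple w g) =
       uniform_measure (tuple_space w G) {h \<in> {2..w} \<rightarrow>\<^sub>E (G - {e}). inj_on h {2..w}}"

definition null_invariance ::
  "'o measure \<Rightarrow> ('x \<Rightarrow> 'x) set \<Rightarrow> ('x \<Rightarrow> real) \<Rightarrow> ('o \<Rightarrow> 'x) \<Rightarrow> bool" where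
  "null_invariance M G T X \<longleftrightarrow>
     (\<forall>g\<in>G. distr M (\<Pi>\<^sub>M b\<in>G. borel) (\<lambda>\<omega>. \<lambda>b\<in>G. T (b (X \<omega>))) =
            distr M (\<Pi>\<^sub>M b\<in>G. borel) (\<lambda>\<omega>. \<lambda>b\<in>G. T (b (g (X \<omega>)))))"

text \<open>In the following, \<open>gs\<close> is the tuple \<open>(gs 1, \<dots>, gs w)\<close>; list positions start at 0,
  whereas order statistics are numbered from 1.\<close>

definition order_stat :: "('x \<Rightarrow> real) \<Rightarrow> nat \<Rightarrow> 'x \<Rightarrow> (nat \<Rightarrow> 'x \<Rightarrow> 'x) \<Rightarrow> nat \<Rightarrow> real" where
  "order_stat T w x gs i = sort (map (\<lambda>j. T (gs j x)) [1..<w + 1]) ! (i - 1)"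

definition crit_value :: "('x \<Rightarrow> real) \<Rightarrow> nat \<Rightarrow> real \<Rightarrow> 'x \<Rightarrow> (nat \<Rightarrow> 'x \<Rightarrow> 'x) \<Rightarrow> real" where
  "crit_value T w \<alpha> x gs = order_stat T w x gs (nat \<lceil>(1 - \<alpha>) * real w\<rceil>)"

definition M_plus :: "('x \<Rightarrow> real) \<Rightarrow> nat \<Rightarrow> real \<Rightarrow> 'x \<Rightarrow> (nat \<Rightarrow> 'x \<Rightarrow> 'x) \<Rightarrow> nat" where
  "M_plus T w \<alpha> x gs = card {j \<in> {1..w}. T (gs j x) > crit_value T w \<alpha> x gs}"

definition M_zero :: "('x \<Rightarrow> real) \<Rightarrow> nat \<Rightarrow> real \<Rightarrow> 'x \<Rightarrow> (nat \<Rightarrow> 'x \<Rightarrow> 'x) \<Rightarrow> nat" where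
  "M_zero T w \<alpha> x gs = card {j \<in> {1..w}. T (gs j x) = crit_value T w \<alpha> x gs}"

definition boundary_prob :: "('x \<Rightarrow> real) \<Rightarrow> nat \<Rightarrow> real \<Rightarrow> 'x \<Rightarrow> (nat \<Rightarrow> 'x \<Rightarrow> 'x) \<Rightarrow> real" where
  "boundary_prob T w \<alpha> x gs =
     (real w * \<alpha> - real (M_plus T w \<alpha> x gs)) / real (M_zero T w \<alpha> x gs)"

definition rejection_prob :: "('x \<Rightarrow> real) \<Rightarrow> nat \<Rightarrow> real \<Rightarrow> 'x \<Rightarrow> (nat \<Rightarrow> 'x \<Rightarrow> 'x) \<Rightarrow> real" where
  "rejection_prob T w \<alpha> x gs =
     of_bool (T x > crit_value T w \<alpha> x gs)
     + boundary_prob T w \<alpha> x gs * of_bool (T x = crit_value T w \<alpha> x gs)"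

end

theory Submission
  imports Defs
begin

text \<open>Re-expressing the tuple \<open>(id, h\<^sub>2, \<dots>, h\<^sub>w)\<close> relative to its \<open>i\<close>-th entry, i.e. multiplying
  it from the right by the inverse of \<open>h\<^sub>i\<close> and then exchanging positions 1 and \<open>i\<close>, is an
  involution on the possible draws that preserves the law of the draw. By the invariance
  hypothesis, the expected rejection probability of the test is therefore unchanged if \<open>T(X)\<close> is
  replaced by \<open>T(g\<^sub>iX)\<close>. Averaging over \<open>i\<close> gives \<open>\<alpha>\<close>, because for every fixed tuple of
  values the weights of the positions add up to \<open>M\<^sup>+ + a M\<^sup>0 = w\<alpha>\<close>.\<close>

section \<open>The weight of a position\<close>

definition kth_smallest :: "nat \<Rightarrow> nat \<Rightarrow> (nat \<Rightarrow> real) \<Rightarrow> real" where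
  "kth_smallest w k u = sort (map u [1..<w + 1]) ! (k - 1)"

text \<open>The test function with the value at position \<open>i\<close> compared to the cutoff in
  place of the value at position 1. Cutoff and boundary probability are symmetric in the values, so
  \<open>i\<close> enters only through the compared value.\<close>

definition position_weight :: "nat \<Rightarrow> nat \<Rightarrow> real \<Rightarrow> (nat \<Rightarrow> real) \<Rightarrow> nat \<Rightarrow> real" where
  "position_weight w k \<alpha> u i =
     of_bool (u i > kth_smallest w k u)
     + (real w * \<alpha> - real (card {j \<in> {1..w}. u j > kth_smallest w k u}))
       / real (card {j \<in> {1..w}. u j = kth_smallest w k u})
       * of_bool (u i = kth_smallest w k u)"

lemma rejection_prob_eq_position_weight:
  assumes "T (gs 1 x) = T x"
  shows "rejection_prob T w \<alpha> x gs =
    position_weight w (nat \<lceil>(1 - \<alpha>) * real w\<rceil>) \<alpha> (\<lambda>j. T (gs j x)) 1"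
  unfolding rejection_prob_def boundary_prob_def M_plus_def M_zero_def crit_value_def
    order_stat_def position_weight_def kth_smallest_def assms ..

lemma kth_smallest_cong:
  assumes "\<And>j. j \<in> {1..w} \<Longrightarrow> u j = v j"
  shows "kth_smallest w k u = kth_smallest w k v"
proof -
  have "map u [1..<w + 1] = map v [1..<w + 1]"
    using assms by (intro map_cong) auto
  then show ?thesis
    unfolding kth_smallest_def by (rule arg_cong)
qed

lemma position_weight_cong:
  assumes "\<And>j. j \<in> {1..w} \<Longrightarrow> u j = v j" and "i \<in> {1..w}"
  shows "position_weight w k \<alpha> u i = position_weight w k \<alpha> v i"
proof -
  have c: "kth_smallest w k u = kth_smallest w k v"
    using assms(1) by (rule kth_smallest_cong)
  have card: "card {j \<in> {1..w}. P (u j)} = card {j \<in> {1..w}. P (v j)}" for P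
    using assms(1) by (intro arg_cong[where f = card]) auto
  show ?thesis
    unfolding position_weight_def c assms(1)[OF assms(2)]
      card[of "\<lambda>y. y > kth_smallest w k v"] card[of "\<lambda>y. y = kth_smallest w k v"] ..
qed

lemma kth_smallest_attained:
  assumes "k \<ge> 1" and "k \<le> w"
  obtains j where "j \<in> {1..w}" and "u j = kth_smallest w k u"
proof -
  have "k - 1 < length (sort (map u [1..<w + 1]))"
    using assms by simp
  then have "kth_smallest w k u \<in> set (sort (map u [1..<w + 1]))"
    unfolding kth_smallest_def by (rule nth_mem)
  then have "kth_smallest w k u \<in> u ` {1..w}"
    by (simp only: set_sort set_map set_upt atLeastLessThanSuc_atLeastAtMost flip: Suc_eq_plus1)
  then show ?thesis
    using that by (metis imageE)
qed

text \<open>The order statistic is itself one of the values, so the number of ties is positive and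
  cancels against the denominator of the boundary probability. Without a tie, division by zero would
  give 0 and the sum would only count the larger values.\<close>

lemma sum_position_weight:
  assumes "k \<ge> 1" and "k \<le> w"
  shows "(\<Sum>i\<in>{1..w}. position_weight w k \<alpha> u i) = real w * \<alpha>"
proof -
  let ?c = "kth_smallest w k u"
  obtain j where "j \<in> {1..w}" and "u j = ?c"
    using kth_smallest_attained[OF assms] .
  then have pos: "card {j \<in> {1..w}. u j = ?c} \<noteq> 0"
    by auto
  have count: "(\<Sum>i\<in>{1..w}. of_bool (P i)) = real (card {j \<in> {1..w}. P j})" for P
    by (simp add: Int_def)
  show ?thesis
    unfolding position_weight_def sum.distrib sum_distrib_left[symmetric] count
    using pos by simp
qed

text \<open>Sorting sees only the multiset of values, and \<open>\<tau>\<close> is a bijection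
  between the index sets that are counted. So cutoff and counts stay fixed while the weights move
  with the positions.\<close>

lemma position_weight_permute:
  assumes "bij_betw \<tau> {1..w} {1..w}"
  shows "position_weight w k \<alpha> (\<lambda>j. u (\<tau> j)) i = position_weight w k \<alpha> u (\<tau> i)"
proof -
  have mset_upt: "mset [1..<w + 1] = mset_set {1..w}"
    by (metis Suc_eq_plus1 atLeastLessThanSuc_atLeastAtMost mset_upt)
  have "image_mset (\<lambda>j. u (\<tau> j)) (mset_set {1..w}) =
      image_mset u (image_mset \<tau> (mset_set {1..w}))"
    by (simp add: image_mset.compositionality comp_def)
  also have "image_mset \<tau> (mset_set {1..w}) = mset_set {1..w}"
    using assms unfolding bij_betw_def by (subst image_mset_mset_set) auto
  finally have "mset (map (\<lambda>j. u (\<tau> j)) [1..<w + 1]) = mset (map u [1..<w + 1])"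
    unfolding mset_map mset_upt .
  then have "sort (map (\<lambda>j. u (\<tau> j)) [1..<w + 1]) = sort (map u [1..<w + 1])"
    by (intro properties_for_sort sorted_sort) (simp only: mset_sort)
  then have c: "kth_smallest w k (\<lambda>j. u (\<tau> j)) = kth_smallest w k u"
    by (simp only: kth_smallest_def)
  have card: "card {j \<in> {1..w}. P (u (\<tau> j))} = card {j \<in> {1..w}. P (u j)}" for P
  proof (rule bij_betw_same_card[of \<tau>])
    have "inj_on \<tau> {j \<in> {1..w}. P (u (\<tau> j))}"
      using assms by (auto simp: bij_betw_def intro: inj_on_subset)
    moreover have "\<tau> ` {j \<in> {1..w}. P (u (\<tau> j))} = {j \<in> \<tau> ` {1..w}. P (u j)}"
      by auto
    ultimately show "bij_betw \<tau> {j \<in> {1..w}. P (u (\<tau> j))} {j \<in> {1..w}. P (u j)}"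
      using assms by (simp add: bij_betw_def)
  qed
  show ?thesis
    unfolding position_weight_def c card[of "\<lambda>y. y > kth_smallest w k u"]
      card[of "\<lambda>y. y = kth_smallest w k u"] ..
qed

text \<open>This bound, uniform in the values, is the source of all integrability below;
  \<open>T(X)\<close> itself may have no expectation.\<close>

lemma abs_position_weight_le: "\<bar>position_weight w k \<alpha> u i\<bar> \<le> 1 + real w * \<bar>\<alpha>\<bar> + real w"
proof -
  let ?p = "real (card {j \<in> {1..w}. u j > kth_smallest w k u})"
  let ?z = "real (card {j \<in> {1..w}. u j = kth_smallest w k u})"
  have "card {j \<in> {1..w}. u j > kth_smallest w k u} \<le> card {1..w}"
    by (intro card_mono) auto
  then have "?p \<le> real w"
    by simp
  have "\<bar>(real w * \<alpha> - ?p) / ?z\<bar> \<le> \<bar>real w * \<alpha> - ?p\<bar>"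
  \<comment> \<open>With \<open>k\<close> arbitrary, a tie is not guaranteed; without one the
    quotient is 0. Otherwise the count is at least 1, and dividing by it cannot increase the
    absolute value.\<close>
  proof (cases "?z = 0")
    case False
    then have "?z \<ge> 1"
      by (metis of_nat_0 of_nat_1 of_nat_le_iff less_one not_le)
    then have "\<bar>x\<bar> / ?z \<le> \<bar>x\<bar> / 1" for x
      by (intro divide_left_mono) auto
    then show ?thesis
      by (simp only: abs_divide abs_of_nat div_by_1)
  next
    case True
    then show ?thesis
      by (simp only: div_by_0 abs_zero abs_ge_zero)
  qed
  also have "\<dots> \<le> \<bar>real w * \<alpha>\<bar> + ?p"
    by linarith
  also have "\<dots> \<le> real w * \<bar>\<alpha>\<bar> + real w"
    using \<open>?p \<le> real w\<close> by (simp add: abs_mult)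
  finally have "\<bar>(real w * \<alpha> - ?p) / ?z\<bar> \<le> real w * \<bar>\<alpha>\<bar> + real w" .
  then show ?thesis
    unfolding position_weight_def by (auto simp: of_bool_def)
qed

section \<open>Measurability of order statistics and weights\<close>

lemma sorted_nth_less_iff:
  fixes t :: "'a::linorder"
  assumes "sorted xs" and "n < length xs"
  shows "xs ! n < t \<longleftrightarrow> n < length (filter (\<lambda>x. x < t) xs)"
  using assms
proof (induction xs arbitrary: n)
  case (Cons x xs)
  show ?case
  proof (cases "x < t")
    case True
    then show ?thesis
      using Cons by (cases n) auto
  next
    case False
    then have "\<forall>y\<in>set (x # xs). \<not> y < t"
      using Cons.prems(1) by auto
    then show ?thesis
      using Cons.prems(2) by (metis filter_False length_0_conv not_less_zero nth_mem)
  qed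
qed simp

text \<open>The entries below \<open>t\<close> form an initial segment of the sorted list, and its
  length can be counted before sorting. This removes \<open>sort\<close> from the measurability
  question.\<close>

lemma kth_smallest_less_iff:
  assumes "k \<ge> 1" and "k \<le> w"
  shows "kth_smallest w k u < t \<longleftrightarrow> k \<le> card {j \<in> {1..w}. u j < t}"
proof -
  have "length (filter (\<lambda>x. x < t) (sort (map u [1..<w + 1])))
      = length (filter (\<lambda>x. x < t) (map u [1..<w + 1]))"
    by (metis mset_filter mset_sort size_mset)
  also have "\<dots> = length (filter (\<lambda>j. u j < t) [1..<w + 1])"
    by (simp add: filter_map comp_def)
  also have "\<dots> = card (set (filter (\<lambda>j. u j < t) [1..<w + 1]))"
    by (intro distinct_card[symmetric]) simp
  also have "set (filter (\<lambda>j. u j < t) [1..<w + 1]) = {j \<in> {1..w}. u j < t}"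
    by auto
  finally show ?thesis
    using assms unfolding kth_smallest_def
    by (subst sorted_nth_less_iff) auto
qed

lemma borel_measurable_card:
  assumes "finite I" and "\<And>j. j \<in> I \<Longrightarrow> Measurable.pred N (P j)"
  shows "(\<lambda>x. real (card {j \<in> I. P j x})) \<in> borel_measurable N"
proof -
  have "real (card {j \<in> I. P j x}) = (\<Sum>j\<in>I. of_bool (P j x))" for x
    using assms(1) by (simp add: Int_def)
  moreover have "(\<lambda>x. \<Sum>j\<in>I. of_bool (P j x) :: real) \<in> borel_measurable N"
    unfolding of_bool_def using assms(2) by (intro borel_measurable_sum) measurable
  ultimately show ?thesis
    by simp
qed

lemma borel_measurable_kth_smallest:
  assumes u: "\<And>j. j \<in> {1..w} \<Longrightarrow> (\<lambda>x. u x j) \<in> borel_measurable N"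
    and k: "k \<ge> 1" "k \<le> w"
  shows "(\<lambda>x. kth_smallest w k (u x)) \<in> borel_measurable N"
\<comment> \<open>Open lower half-lines suffice; on them the condition is a threshold on a count,
  which is a finite sum of indicators.\<close>
proof (rule borel_measurableI_less)
  fix t
  have "(\<lambda>x. real (card {j \<in> {1..w}. u x j < t})) \<in> borel_measurable N"
    using u by (intro borel_measurable_card) measurable
  then have "{x \<in> space N. real k \<le> real (card {j \<in> {1..w}. u x j < t})} \<in> sets N"
    by measurable
  then show "{x \<in> space N. kth_smallest w k (u x) < t} \<in> sets N"
    by (simp only: kth_smallest_less_iff[OF k] of_nat_le_iff)
qed

lemma borel_measurable_position_weight:
  assumes u: "\<And>j. j \<in> {1..w} \<Longrightarrow> (\<lambda>x. u x j) \<in> borel_measurable N"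
    and k: "k \<ge> 1" "k \<le> w" and i: "i \<in> {1..w}"
  shows "(\<lambda>x. position_weight w k \<alpha> (u x) i) \<in> borel_measurable N"
proof -
  note c [measurable] = borel_measurable_kth_smallest[of w u N, OF u k]
  note ui [measurable] = u[OF i]
  have "(\<lambda>x. real (card {j \<in> {1..w}. u x j > kth_smallest w k (u x)})) \<in> borel_measurable N"
    and "(\<lambda>x. real (card {j \<in> {1..w}. u x j = kth_smallest w k (u x)})) \<in> borel_measurable N"
    using u by (intro borel_measurable_card finite_atLeastAtMost; measurable)+
  note [measurable] = this
  show ?thesis
    unfolding position_weight_def of_bool_def by measurable
qed

section \<open>Changing the reference element of a tuple\<close>

text \<open>Position 1 always holds the unit and is not stored. After the right multiplication it
  holds \<open>h i\<close> times its inverse, the unit, and position \<open>i\<close> holds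
  \<open>h i\<close>; more precisely, the old unit at position 1 becomes the inverse of
  \<open>h i\<close>, and the exchange puts that at position \<open>i\<close>.\<close>

definition repivot :: "('g, 'm) monoid_scheme \<Rightarrow> nat \<Rightarrow> nat \<Rightarrow> (nat \<Rightarrow> 'g) \<Rightarrow> nat \<Rightarrow> 'g" where
  "repivot L w i h =
     (\<lambda>j\<in>{2..w}. if j = i then inv\<^bsub>L\<^esub> (h i) else h j \<otimes>\<^bsub>L\<^esub> inv\<^bsub>L\<^esub> (h i))"

context group
begin

lemma repivot_closed:
  assumes "h \<in> {2..w} \<rightarrow>\<^sub>E carrier G" and "i \<in> {2..w}"
  shows "repivot G w i h \<in> {2..w} \<rightarrow>\<^sub>E carrier G"
proof -
  have "h j \<in> carrier G" if "j \<in> {2..w}" for j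
    using assms(1) that by (rule PiE_mem)
  then show ?thesis
    using assms(2) by (auto simp: repivot_def)
qed

text \<open>The new entry at \<open>i\<close> is the inverse of the old one, so the second
  application multiplies by \<open>h i\<close> and undoes the first.\<close>

lemma repivot_involution:
  assumes h: "h \<in> {2..w} \<rightarrow>\<^sub>E carrier G" and i: "i \<in> {2..w}"
  shows "repivot G w i (repivot G w i h) = h"
proof
  fix j
  have closed: "h j \<in> carrier G" if "j \<in> {2..w}" for j
    using h that by (rule PiE_mem)
  show "repivot G w i (repivot G w i h) j = h j"
  proof (cases "j \<in> {2..w}")
    case True
    then show ?thesis
      using closed[OF True] closed[OF i] i by (simp add: repivot_def m_assoc)
  next
    case False
    then show ?thesis
      using PiE_arb[OF h False] by (simp only: repivot_def restrict_apply False if_False)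
  qed
qed

text \<open>Undoing the right multiplication leaves just the exchange of positions. This is how
  evaluating the new tuple at \<open>h i\<close> applied to \<open>X\<close> leads back to the old
  tuple at \<open>X\<close>.\<close>

lemma repivot_mult_pivot:
  assumes h: "h \<in> {2..w} \<rightarrow>\<^sub>E carrier G" and i: "i \<in> {2..w}" and j: "j \<in> {1..w}"
  shows "((repivot G w i h)(1 := \<one>)) j \<otimes> h i = (h(1 := \<one>)) (Transposition.transpose 1 i j)"
proof -
  have closed: "h j \<in> carrier G" if "j \<in> {2..w}" for j
    using h that by (rule PiE_mem)
  consider "j = 1" | "j = i" "j \<noteq> 1" | "j \<noteq> i" "j \<in> {2..w}" "j \<noteq> 1"
    using i j by fastforce
  then show ?thesis
    by cases (use closed[of j] closed[OF i] i in \<open>auto simp: repivot_def m_assoc transpose_def\<close>)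
qed

text \<open>The hypotheses say that the unit and the entries of \<open>h\<close> are pairwise
  distinct. Right translation is injective and an exchange of positions is harmless, so distinctness
  survives.\<close>

lemma repivot_inj:
  assumes h: "h \<in> {2..w} \<rightarrow>\<^sub>E (carrier G - {\<one>})" and inj: "inj_on h {2..w}" and i: "i \<in> {2..w}"
  shows "repivot G w i h \<in> {2..w} \<rightarrow>\<^sub>E (carrier G - {\<one>})" and "inj_on (repivot G w i h) {2..w}"
proof -
  have closed: "h j \<in> carrier G" "h j \<noteq> \<one>" if "j \<in> {2..w}" for j
    using PiE_mem[OF h that] by auto
  have neq: "h j \<noteq> h i" if "j \<in> {2..w}" "j \<noteq> i" for j
    using inj i that by (auto dest: inj_onD)
  show "repivot G w i h \<in> {2..w} \<rightarrow>\<^sub>E (carrier G - {\<one>})"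
  proof (rule PiE_I)
    fix j assume j: "j \<in> {2..w}"
    have "inv (h i) \<noteq> \<one>"
      using closed[OF i] by (simp add: inv_eq_1_iff)
    moreover have "h j \<otimes> inv (h i) \<noteq> \<one>" if "j \<noteq> i"
    proof
      assume "h j \<otimes> inv (h i) = \<one>"
      then have "inv (inv (h i)) = h j"
        using closed(1)[OF i] closed(1)[OF j] by (intro inv_equality) auto
      then show False
        using neq[OF j that] closed(1)[OF i] by simp
    qed
    ultimately show "repivot G w i h j \<in> carrier G - {\<one>}"
      using j closed(1)[OF i] closed(1)[OF j] by (auto simp: repivot_def)
  qed (auto simp: repivot_def)
  show "inj_on (repivot G w i h) {2..w}"
  proof (rule inj_onI)
    fix j l assume j: "j \<in> {2..w}" and l: "l \<in> {2..w}"
      and eq: "repivot G w i h j = repivot G w i h l"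
    \<comment> \<open>The entry at \<open>i\<close> plays the role of the translated unit; it could
      collide with another entry only if some \<open>h m\<close> were the unit.\<close>
    have no_unit: "h m \<otimes> inv (h i) \<noteq> inv (h i)" if "m \<in> {2..w}" for m
      using closed[OF that] closed(1)[OF i] by simp
    have "(if j = i then inv (h i) else h j \<otimes> inv (h i)) =
        (if l = i then inv (h i) else h l \<otimes> inv (h i))"
      using eq by (simp only: repivot_def restrict_apply j l if_True)
    then have "j = l \<or> h j \<otimes> inv (h i) = h l \<otimes> inv (h i)"
      using no_unit[OF j] no_unit[OF l] by (auto split: if_splits)
    then have "j = l \<or> h j = h l"
      using closed(1)[OF i] closed(1)[OF j] closed(1)[OF l] by simp
    then show "j = l"
      using inj j l by (auto dest: inj_onD)
  qed
qed

end

section \<open>The law of the drawn tuple\<close>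

text \<open>The value does not depend on \<open>h\<close>, so any map of tuples into the same set
  preserves point masses.\<close>

lemma with_replacement_prob:
  assumes "prob_space M" and "finite G" and draw: "drawn_with_replacement M G w g"
    and h: "h \<in> {2..w} \<rightarrow>\<^sub>E G"
  shows "measure M {\<omega> \<in> space M. drawn_tuple w g \<omega> = h} = (1 / real (card G)) ^ (w - 1)"
proof -
  interpret prob_space M by fact
  have hG: "h j \<in> G" if "j \<in> {2..w}" for j
    using h that by (rule PiE_mem)
  have indep: "indep_vars (\<lambda>_. count_space G) g {2..w}"
    and unif: "\<And>j. j \<in> {2..w} \<Longrightarrow> distr M (count_space G) (g j) = uniform_count_measure G"
    using draw by (auto simp: drawn_with_replacement_def)
  have single: "prob (g j -` {h j} \<inter> space M) = 1 / real (card G)" if j: "j \<in> {2..w}" for j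
  proof -
    have "g j \<in> M \<rightarrow>\<^sub>M count_space G"
      using indep j by (simp add: indep_vars_def)
    then have "prob (g j -` {h j} \<inter> space M) = measure (distr M (count_space G) (g j)) {h j}"
      using hG[OF j] by (simp add: measure_distr)
    then show ?thesis
      using hG[OF j] \<open>finite G\<close> by (simp add: unif[OF j] measure_uniform_count_measure)
  qed
  have eq: "drawn_tuple w g \<omega> = h \<longleftrightarrow> (\<forall>j\<in>{2..w}. g j \<omega> = h j)" for \<omega>
  proof
    assume "drawn_tuple w g \<omega> = h"
    then show "\<forall>j\<in>{2..w}. g j \<omega> = h j"
      by (auto simp: drawn_tuple_def)
  next
    assume *: "\<forall>j\<in>{2..w}. g j \<omega> = h j"
    show "drawn_tuple w g \<omega> = h"
      unfolding drawn_tuple_def by (rule extensionalityI[of _ "{2..w}"]) (use * h in \<open>auto simp: PiE_def\<close>)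
  qed
  show ?thesis
  \<comment> \<open>For \<open>w\<close> at most 1 nothing is drawn and the event is the whole
    space; the product rule for independent families is applied to a nonempty index set.\<close>
  proof (cases "{2..w} = {}")
    case True
    then show ?thesis
      unfolding eq by (simp add: prob_space)
  next
    case False
    then have "{\<omega> \<in> space M. drawn_tuple w g \<omega> = h} = (\<Inter>j\<in>{2..w}. g j -` {h j} \<inter> space M)"
      unfolding eq by auto
    also have "prob \<dots> = (\<Prod>j\<in>{2..w}. prob (g j -` {h j} \<inter> space M))"
      using indep False hG by (intro indep_varsD_finite) auto
    also have "\<dots> = (\<Prod>j\<in>{2..w}. 1 / real (card G))"
      by (intro prod.cong refl single)
    also have "\<dots> = (1 / real (card G)) ^ (w - 1)"
      by (simp only: prod_constant card_atLeastAtMost) simp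
    finally show ?thesis .
  qed
qed

text \<open>Under a uniform law a point mass depends only on whether the point lies in the
  supporting set. The normalising constant is common to both tuples and is never evaluated.\<close>

lemma without_replacement_prob_eq:
  assumes draw: "drawn_without_replacement M G e w g"
    and h: "h \<in> {2..w} \<rightarrow>\<^sub>E G" and h': "h' \<in> {2..w} \<rightarrow>\<^sub>E G"
    and iff: "(h' \<in> {2..w} \<rightarrow>\<^sub>E (G - {e}) \<and> inj_on h' {2..w}) \<longleftrightarrow>
      (h \<in> {2..w} \<rightarrow>\<^sub>E (G - {e}) \<and> inj_on h {2..w})"
  shows "measure M {\<omega> \<in> space M. drawn_tuple w g \<omega> = h'} =
    measure M {\<omega> \<in> space M. drawn_tuple w g \<omega> = h}"
proof -
  let ?N = "tuple_space w G" and ?H = "drawn_tuple w g"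
  let ?K = "{h \<in> {2..w} \<rightarrow>\<^sub>E (G - {e}). inj_on h {2..w}}"
  have H: "?H \<in> M \<rightarrow>\<^sub>M ?N" and law: "distr M ?N ?H = uniform_measure ?N ?K"
    using draw by (auto simp: drawn_without_replacement_def)
  have K: "?K \<in> sets ?N"
    unfolding tuple_space_def by (auto simp: PiE_iff extensional_def)
  have emeasure: "emeasure M {\<omega> \<in> space M. ?H \<omega> = k} = of_bool (k \<in> ?K) / emeasure ?N ?K"
    if k: "k \<in> {2..w} \<rightarrow>\<^sub>E G" for k
  proof -
    have sets: "{k} \<in> sets ?N"
      using k by (simp add: tuple_space_def)
    have "{\<omega> \<in> space M. ?H \<omega> = k} = ?H -` {k} \<inter> space M"
      by auto
    then have "emeasure M {\<omega> \<in> space M. ?H \<omega> = k} = emeasure (distr M ?N ?H) {k}"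
      by (simp add: emeasure_distr[OF H sets])
    also have "\<dots> = emeasure ?N (?K \<inter> {k}) / emeasure ?N ?K"
      unfolding law using K sets by (rule emeasure_uniform_measure)
    also have "emeasure ?N (?K \<inter> {k}) = of_bool (k \<in> ?K)"
    proof (cases "k \<in> ?K")
      case True
      then have "?K \<inter> {k} = {k}"
        by blast
      with True k show ?thesis
        by (simp only: tuple_space_def) (subst emeasure_count_space_finite; simp)
    next
      case False
      then have "?K \<inter> {k} = {}"
        by blast
      with False show ?thesis
        by (simp only: emeasure_empty of_bool_eq)
    qed
    finally show ?thesis .
  qed
  show ?thesis
    unfolding measure_def emeasure[OF h] emeasure[OF h'] mem_Collect_eq iff ..
qed

lemma drawn_tuple_prob_repivot:
  assumes "prob_space M" and "finite (carrier L)" and "group L"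
    and draw: "drawn_with_replacement M (carrier L) w g \<or>
      drawn_without_replacement M (carrier L) \<one>\<^bsub>L\<^esub> w g"
    and h: "h \<in> {2..w} \<rightarrow>\<^sub>E carrier L" and i: "i \<in> {2..w}"
  shows "measure M {\<omega> \<in> space M. drawn_tuple w g \<omega> = repivot L w i h} =
    measure M {\<omega> \<in> space M. drawn_tuple w g \<omega> = h}"
proof -
  interpret group L by fact
  note closed = repivot_closed[OF h i]
  show ?thesis
    using draw
  proof
    assume "drawn_with_replacement M (carrier L) w g"
    then show ?thesis
      by (simp only: with_replacement_prob[OF assms(1,2) _ h] with_replacement_prob[OF assms(1,2) _ closed])
  next
    assume draw': "drawn_without_replacement M (carrier L) \<one>\<^bsub>L\<^esub> w g"
    show ?thesis
      \<comment> \<open>The second instance, combined with the involution, yields the converse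
        direction of the equivalence.\<close>
      using repivot_inj[of h w i] repivot_inj[of "repivot L w i h" w i] i
      unfolding repivot_involution[OF h i]
      by (intro without_replacement_prob_eq[OF draw' h closed]) blast
  qed
qed

section \<open>Conditioning on an independent draw\<close>

text \<open>Since \<open>H\<close> has finitely many values, the integrand splits along the events
  that \<open>H\<close> equals \<open>h\<close>; independence factors each summand.\<close>

lemma (in prob_space) expectation_indep_draw:
  assumes indep: "indep_elements M S X (count_space I) H" and "finite I"
    and F: "\<And>h. h \<in> I \<Longrightarrow> F h \<in> borel_measurable S"
    and bound: "\<And>h x. \<bar>F h x :: real\<bar> \<le> B"
  shows "integrable M (\<lambda>\<omega>. F (H \<omega>) (X \<omega>))"
    and "expectation (\<lambda>\<omega>. F (H \<omega>) (X \<omega>)) =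
      (\<Sum>h\<in>I. prob {\<omega> \<in> space M. H \<omega> = h} * expectation (\<lambda>\<omega>. F h (X \<omega>)))"
proof -
  let ?Z = "\<lambda>h \<omega>. indicator {h} (H \<omega>) :: real"
  have X [measurable]: "X \<in> M \<rightarrow>\<^sub>M S" and H [measurable]: "H \<in> M \<rightarrow>\<^sub>M count_space I"
    and indep_alg: "indep_set (sets (vimage_algebra (space M) X S))
      (sets (vimage_algebra (space M) H (count_space I)))"
    using indep by (auto simp: indep_elements_def)
  have FX: "(\<lambda>\<omega>. F h (X \<omega>)) \<in> borel_measurable M" if "h \<in> I" for h
    using X F[OF that] by (rule measurable_compose)
  have int_F: "integrable M (\<lambda>\<omega>. F h (X \<omega>))" if "h \<in> I" for h
    using FX[OF that] bound by (intro integrable_const_bound[where B = B]) auto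
  have Z: "?Z h \<in> borel_measurable M" for h
    by (rule measurable_compose[OF H]) simp
  then have int_Z: "integrable M (?Z h)" for h
    by (intro integrable_const_bound[where B = 1]) auto
  have indep_FZ: "indep_var borel (\<lambda>\<omega>. F h (X \<omega>)) borel (?Z h)" if h: "h \<in> I" for h
  proof -
    have "X \<in> vimage_algebra (space M) X S \<rightarrow>\<^sub>M S"
      by (rule measurable_vimage_algebra1) (rule funcsetI, rule measurable_space[OF X])
    then have 1: "(\<lambda>\<omega>. F h (X \<omega>)) \<in> vimage_algebra (space M) X S \<rightarrow>\<^sub>M borel"
      using F[OF h] by (rule measurable_compose)
    have "H \<in> vimage_algebra (space M) H (count_space I) \<rightarrow>\<^sub>M count_space I"
      by (rule measurable_vimage_algebra1) (rule funcsetI, rule measurable_space[OF H])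
    then have 2: "?Z h \<in> vimage_algebra (space M) H (count_space I) \<rightarrow>\<^sub>M borel"
      by (rule measurable_compose) simp
    \<comment> \<open>The two real variables generate sigma-algebras contained in those generated by
      \<open>X\<close> and \<open>H\<close>, so they inherit independence.\<close>
    have sub: "sigma_sets (space M) {Y -` A \<inter> space M |A. A \<in> sets borel} \<subseteq> sets N"
      if "Y \<in> N \<rightarrow>\<^sub>M (borel :: real measure)" "space N = space M" for Y N
      unfolding that(2)[symmetric] by (rule sets.sigma_sets_subset) (blast intro: measurable_sets[OF that(1)])
    show ?thesis
      unfolding indep_var_eq
    proof (intro conjI FX[OF h] Z)
      show "indep_set (sigma_sets (space M) {(\<lambda>\<omega>. F h (X \<omega>)) -` A \<inter> space M |A. A \<in> sets borel})
          (sigma_sets (space M) {?Z h -` A \<inter> space M |A. A \<in> sets borel})"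
        using sub[OF 1] sub[OF 2] indep_setD_ev1[OF indep_alg] indep_setD_ev2[OF indep_alg]
        unfolding indep_sets2_eq space_vimage_algebra
        by (intro conjI ballI indep_setD[OF indep_alg]) (blast intro: refl)+
    qed
  qed
  have split: "F (H \<omega>) (X \<omega>) = (\<Sum>h\<in>I. F h (X \<omega>) * ?Z h \<omega>)" if "\<omega> \<in> space M" for \<omega>
  proof -
    have "H \<omega> \<in> I"
      using measurable_space[OF H that] by simp
    have "(\<Sum>h\<in>I. F h (X \<omega>) * ?Z h \<omega>) = (\<Sum>h\<in>I. if h = H \<omega> then F h (X \<omega>) else 0)"
      by (intro sum.cong refl) (auto split: split_indicator)
    also have "\<dots> = F (H \<omega>) (X \<omega>)"
      using \<open>finite I\<close> \<open>H \<omega> \<in> I\<close> by (simp only: sum.delta if_True)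
    finally show ?thesis ..
  qed
  have int_prod: "integrable M (\<lambda>\<omega>. F h (X \<omega>) * ?Z h \<omega>)" if "h \<in> I" for h
    using indep_FZ[OF that] int_F[OF that] int_Z by (rule indep_var_integrable)
  then have "integrable M (\<lambda>\<omega>. \<Sum>h\<in>I. F h (X \<omega>) * ?Z h \<omega>)"
    by (rule Bochner_Integration.integrable_sum)
  then show "integrable M (\<lambda>\<omega>. F (H \<omega>) (X \<omega>))"
    by (subst Bochner_Integration.integrable_cong[OF refl split])
  have "expectation (\<lambda>\<omega>. F (H \<omega>) (X \<omega>)) = expectation (\<lambda>\<omega>. \<Sum>h\<in>I. F h (X \<omega>) * ?Z h \<omega>)"
    by (rule Bochner_Integration.integral_cong[OF refl split])
  also have "\<dots> = (\<Sum>h\<in>I. expectation (\<lambda>\<omega>. F h (X \<omega>) * ?Z h \<omega>))"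
    using int_prod by (rule Bochner_Integration.integral_sum)
  also have "\<dots> = (\<Sum>h\<in>I. prob {\<omega> \<in> space M. H \<omega> = h} * expectation (\<lambda>\<omega>. F h (X \<omega>)))"
  proof (rule sum.cong[OF refl])
    fix h assume h: "h \<in> I"
    have "{\<omega> \<in> space M. H \<omega> = h} = H -` {h} \<inter> space M"
      by auto
    then have ev: "{\<omega> \<in> space M. H \<omega> = h} \<in> events"
      using measurable_sets[OF H, of "{h}"] h by simp
    have "expectation (?Z h) = expectation (indicator {\<omega> \<in> space M. H \<omega> = h})"
      by (intro Bochner_Integration.integral_cong) (auto simp: indicator_def)
    also have "\<dots> = prob {\<omega> \<in> space M. H \<omega> = h}"
      using sets.sets_into_space[OF ev] by (simp only: Bochner_Integration.integral_indicator Int_absorb2)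
    finally show "expectation (\<lambda>\<omega>. F h (X \<omega>) * ?Z h \<omega>) =
        prob {\<omega> \<in> space M. H \<omega> = h} * expectation (\<lambda>\<omega>. F h (X \<omega>))"
      using indep_var_lebesgue_integral[OF indep_FZ[OF h] int_F[OF h] int_Z] by simp
  qed
  finally show "expectation (\<lambda>\<omega>. F (H \<omega>) (X \<omega>)) =
      (\<Sum>h\<in>I. prob {\<omega> \<in> space M. H \<omega> = h} * expectation (\<lambda>\<omega>. F h (X \<omega>)))" .
qed

section \<open>Level of the test\<close>

text \<open>Both sides are integrals of \<open>F\<close> against push-forward laws on the product
  space, which the hypothesis identifies.\<close>

lemma null_invariance_integral:
  assumes null: "null_invariance M G T X" and X: "X \<in> M \<rightarrow>\<^sub>M S"
    and G: "\<And>b. b \<in> G \<Longrightarrow> b \<in> S \<rightarrow>\<^sub>M S" and T: "T \<in> borel_measurable S" and g: "g \<in> G"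
    and F: "F \<in> borel_measurable (\<Pi>\<^sub>M b\<in>G. (borel :: real measure))"
  shows "integral\<^sup>L M (\<lambda>\<omega>. F (\<lambda>b\<in>G. T (b (X \<omega>))) :: real) =
    integral\<^sup>L M (\<lambda>\<omega>. F (\<lambda>b\<in>G. T (b (g (X \<omega>)))))"
proof -
  let ?P = "\<Pi>\<^sub>M b\<in>G. (borel :: real measure)"
  have 1: "(\<lambda>\<omega>. \<lambda>b\<in>G. T (b (X \<omega>))) \<in> M \<rightarrow>\<^sub>M ?P"
    by (rule measurable_restrict) (rule measurable_compose[OF measurable_compose[OF X G] T])
  have 2: "(\<lambda>\<omega>. \<lambda>b\<in>G. T (b (g (X \<omega>)))) \<in> M \<rightarrow>\<^sub>M ?P"
    by (rule measurable_restrict)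
      (rule measurable_compose[OF measurable_compose[OF measurable_compose[OF X G[OF g]] G] T])
  show ?thesis
    using null g integral_distr[OF 1 F] integral_distr[OF 2 F]
    by (simp add: null_invariance_def)
qed

text \<open>For a fixed draw, invariance replaces \<open>X\<close> by \<open>h i\<close> applied to
  \<open>X\<close>. This turns the repivoted tuple into the old one with positions 1 and
  \<open>i\<close> exchanged, and permuting the values back moves the tested position to
  \<open>i\<close>.\<close>

lemma expectation_position_weight_repivot:
  fixes A G defines "L \<equiv> composition_monoid A G"
  assumes trans: "transformation_group A G" and A: "A = space S"
    and null: "null_invariance M G T X" and X: "X \<in> M \<rightarrow>\<^sub>M S"
    and G: "\<And>b. b \<in> G \<Longrightarrow> b \<in> S \<rightarrow>\<^sub>M S" and T: "T \<in> borel_measurable S"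
    and k: "k \<ge> 1" "k \<le> w" and h: "h \<in> {2..w} \<rightarrow>\<^sub>E G" and i: "i \<in> {2..w}"
  shows "integral\<^sup>L M (\<lambda>\<omega>. position_weight w k \<alpha>
      (\<lambda>j. T (((repivot L w i h)(1 := \<one>\<^bsub>L\<^esub>)) j (X \<omega>))) 1) =
    integral\<^sup>L M (\<lambda>\<omega>. position_weight w k \<alpha> (\<lambda>j. T ((h(1 := \<one>\<^bsub>L\<^esub>)) j (X \<omega>))) i)"
proof -
  interpret group L
    using trans by (simp add: transformation_group_def L_def)
  have carrier: "carrier L = G" and mult: "mult L = compose A"
    by (simp_all add: L_def composition_monoid_def)
  let ?q = "(repivot L w i h)(1 := \<one>\<^bsub>L\<^esub>)" and ?\<tau> = "Transposition.transpose 1 i"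
  \<comment> \<open>Read as a function of the vector indexed by \<open>G\<close>, the weight falls
    under the invariance of the joint law.\<close>
  let ?F = "\<lambda>v. position_weight w k \<alpha> (\<lambda>j. v (?q j)) 1"
  have w: "1 \<in> {1..w}"
    using k by simp
  have hi: "h i \<in> G"
    using h i by (rule PiE_mem)
  have h': "h \<in> {2..w} \<rightarrow>\<^sub>E carrier L"
    using h by (simp add: carrier)
  have q: "?q j \<in> G" if "j \<in> {1..w}" for j
  proof (cases "j = 1")
    case True
    then show ?thesis
      using one_closed by (simp add: carrier)
  next
    case False
    then show ?thesis
      using PiE_mem[OF repivot_closed[OF h' i], of j] that by (simp add: carrier)
  qed
  have F: "?F \<in> borel_measurable (\<Pi>\<^sub>M b\<in>G. borel)"
    using q by (intro borel_measurable_position_weight k w measurable_component_singleton)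
  have "integral\<^sup>L M (\<lambda>\<omega>. position_weight w k \<alpha> (\<lambda>j. T (?q j (X \<omega>))) 1)
      = integral\<^sup>L M (\<lambda>\<omega>. ?F (\<lambda>b\<in>G. T (b (X \<omega>))))"
    using q by (intro Bochner_Integration.integral_cong refl position_weight_cong w) simp
  also have "\<dots> = integral\<^sup>L M (\<lambda>\<omega>. ?F (\<lambda>b\<in>G. T (b (h i (X \<omega>)))))"
    by (rule null_invariance_integral[OF null X G T hi F])
  also have "\<dots> = integral\<^sup>L M (\<lambda>\<omega>. position_weight w k \<alpha> (\<lambda>j. T ((h(1 := \<one>\<^bsub>L\<^esub>)) (?\<tau> j) (X \<omega>))) 1)"
  proof (intro Bochner_Integration.integral_cong refl position_weight_cong w)
    fix \<omega> j assume \<omega>: "\<omega> \<in> space M" and j: "j \<in> {1..w}"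
    \<comment> \<open>The group product \<open>compose A\<close> agrees with composition only at
      points of \<open>A\<close>.\<close>
    have "X \<omega> \<in> A"
      using measurable_space[OF X \<omega>] by (simp add: A)
    then have "?q j (h i (X \<omega>)) = (?q j \<otimes>\<^bsub>L\<^esub> h i) (X \<omega>)"
      by (simp add: mult compose_eq)
    also have "\<dots> = (h(1 := \<one>\<^bsub>L\<^esub>)) (?\<tau> j) (X \<omega>)"
      unfolding repivot_mult_pivot[OF h' i j] ..
    finally show "(\<lambda>b\<in>G. T (b (h i (X \<omega>)))) (?q j) = T ((h(1 := \<one>\<^bsub>L\<^esub>)) (?\<tau> j) (X \<omega>))"
      using q[OF j] by simp
  qed
  also have "\<dots> = integral\<^sup>L M (\<lambda>\<omega>. position_weight w k \<alpha> (\<lambda>j. T ((h(1 := \<one>\<^bsub>L\<^esub>)) j (X \<omega>))) i)"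
  proof -
    have "?\<tau> permutes {1..w}"
      using i w by (intro permutes_swap_id) auto
    then have "bij_betw ?\<tau> {1..w} {1..w}"
      by (rule permutes_imp_bij)
    then have "position_weight w k \<alpha> (\<lambda>j. T ((h(1 := \<one>\<^bsub>L\<^esub>)) (?\<tau> j) x)) 1 =
        position_weight w k \<alpha> (\<lambda>j. T ((h(1 := \<one>\<^bsub>L\<^esub>)) j x)) (?\<tau> 1)" for x
      by (rule position_weight_permute)
    then show ?thesis
      by (simp only: transpose_apply_first)
  qed
  finally show ?thesis .
qed

theorem proposition3:
  fixes M :: "'o measure" and S :: "'x measure"
    and X :: "'o \<Rightarrow> 'x" and G :: "('x \<Rightarrow> 'x) set" and T :: "'x \<Rightarrow> real"
    and w :: nat and g :: "nat \<Rightarrow> 'o \<Rightarrow> 'x \<Rightarrow> 'x" and \<alpha> :: real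
  assumes "prob_space M"
    and "X \<in> M \<rightarrow>\<^sub>M S"
    and "finite G"
    and "transformation_group (space S) G"
    and "\<And>h. h \<in> G \<Longrightarrow> h \<in> S \<rightarrow>\<^sub>M S"
    and "T \<in> borel_measurable S"
    and "w \<ge> 1"
    and "\<And>\<omega>. \<omega> \<in> space M \<Longrightarrow> g 1 \<omega> = (\<lambda>x\<in>space S. x)"
    and "indep_elements M S X (tuple_space w G) (drawn_tuple w g)"
    and "drawn_with_replacement M G w g \<or>
         drawn_without_replacement M G (\<lambda>x\<in>space S. x) w g"
    and "0 \<le> \<alpha>" and "\<alpha> < 1"
    and "null_invariance M G T X"
  shows "integrable M (\<lambda>\<omega>. rejection_prob T w \<alpha> (X \<omega>) (\<lambda>j. g j \<omega>)) \<and>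
         prob_space.expectation M (\<lambda>\<omega>. rejection_prob T w \<alpha> (X \<omega>) (\<lambda>j. g j \<omega>)) = \<alpha>"
proof -
  interpret prob_space M by fact
  define L where "L = composition_monoid (space S) G"
  interpret L: group L
    using assms(4) by (simp add: transformation_group_def L_def)
  have carrier: "carrier L = G" and one: "\<one>\<^bsub>L\<^esub> = (\<lambda>x\<in>space S. x)"
    by (simp_all add: L_def composition_monoid_def)
  note X = assms(2) and T = assms(6)
  define k where "k = nat \<lceil>(1 - \<alpha>) * real w\<rceil>"
  \<comment> \<open>These bounds place the ceiling in the range from 1 to \<open>w\<close>, so
    \<open>nat\<close> does not truncate and the order statistic exists.\<close>
  have "(1 - \<alpha>) * real w > 0" and "(1 - \<alpha>) * real w \<le> real w"
    using \<open>\<alpha> < 1\<close> \<open>0 \<le> \<alpha>\<close> \<open>w \<ge> 1\<close> by (auto simp: mult_left_le_one_le)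
  then have k: "k \<ge> 1" "k \<le> w"
    unfolding k_def by linarith+
  have w: "1 \<in> {1..w}"
    using \<open>w \<ge> 1\<close> by simp
  let ?H = "drawn_tuple w g" and ?I = "{2..w} \<rightarrow>\<^sub>E G"
  \<comment> \<open>The update at 1 restores the fixed first entry to a draw indexed from 2. Thus
    \<open>F 1\<close> is the test, and the other \<open>F i\<close> are its competitors in the
    averaging.\<close>
  define F where "F i h x = position_weight w k \<alpha> (\<lambda>j. T ((h(1 := \<one>\<^bsub>L\<^esub>)) j x)) i" for i h x
  define p where "p h = prob {\<omega> \<in> space M. ?H \<omega> = h}" for h
  define W where "W i h = expectation (\<lambda>\<omega>. F i h (X \<omega>))" for i h
  have indep: "indep_elements M S X (count_space ?I) ?H"
    using assms(9) by (simp add: tuple_space_def)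
  have finI: "finite ?I"
    using \<open>finite G\<close> by (intro finite_PiE) auto
  have entry: "(h(1 := \<one>\<^bsub>L\<^esub>)) j \<in> G" if "h \<in> ?I" "j \<in> {1..w}" for h j
    using PiE_mem[OF that(1), of j] that(2) L.one_closed by (auto simp: carrier)
  have F: "F i h \<in> borel_measurable S" if "h \<in> ?I" "i \<in> {1..w}" for i h
    unfolding F_def using that(2)
    by (intro borel_measurable_position_weight k measurable_compose[OF assms(5) T] entry[OF that(1)])
  have bound: "\<bar>F i h x\<bar> \<le> 1 + real w * \<bar>\<alpha>\<bar> + real w" for i h x
    unfolding F_def by (rule abs_position_weight_le)
  have rej: "rejection_prob T w \<alpha> (X \<omega>) (\<lambda>j. g j \<omega>) = F 1 (?H \<omega>) (X \<omega>)" if \<omega>: "\<omega> \<in> space M" for \<omega>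
  proof -
    have g1: "g 1 \<omega> (X \<omega>) = X \<omega>"
      using measurable_space[OF X \<omega>] assms(8)[OF \<omega>] by simp
    have "position_weight w k \<alpha> (\<lambda>j. T (g j \<omega> (X \<omega>))) 1 = F 1 (?H \<omega>) (X \<omega>)"
      unfolding F_def using assms(8)[OF \<omega>]
      by (intro position_weight_cong w) (auto simp: drawn_tuple_def one)
    then show ?thesis
      using g1 unfolding k_def by (simp add: rejection_prob_eq_position_weight)
  qed
  have int: "integrable M (\<lambda>\<omega>. rejection_prob T w \<alpha> (X \<omega>) (\<lambda>j. g j \<omega>))"
    using expectation_indep_draw(1)[OF indep finI, of "F 1", OF F[OF _ w] bound]
    by (subst Bochner_Integration.integrable_cong[OF refl rej])
  have ex: "expectation (\<lambda>\<omega>. rejection_prob T w \<alpha> (X \<omega>) (\<lambda>j. g j \<omega>)) = (\<Sum>h\<in>?I. p h * W 1 h)"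
    using expectation_indep_draw(2)[OF indep finI, of "F 1", OF F[OF _ w] bound]
    unfolding p_def W_def by (subst Bochner_Integration.integral_cong[OF refl rej])
  have pivot: "(\<Sum>h\<in>?I. p h * W 1 h) = (\<Sum>h\<in>?I. p h * W i h)" if i: "i \<in> {1..w}" for i
  proof (cases "i = 1")
    case False
    then have i2: "i \<in> {2..w}"
      using i by auto
    let ?\<sigma> = "repivot L w i"
    have \<sigma>: "?\<sigma> h \<in> ?I" "?\<sigma> (?\<sigma> h) = h" if "h \<in> ?I" for h
      using L.repivot_closed[of h w i] L.repivot_involution[of h w i] that i2 by (auto simp: carrier)
    have "(\<Sum>h\<in>?I. p h * W 1 h) = (\<Sum>h\<in>?I. p (?\<sigma> h) * W 1 (?\<sigma> h))"
      \<comment> \<open>An involution is its own inverse and serves as both witnesses.\<close>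
      by (rule sum.reindex_bij_witness[of _ ?\<sigma> ?\<sigma>]) (use \<sigma> in auto)
    also have "\<dots> = (\<Sum>h\<in>?I. p h * W i h)"
    proof (rule sum.cong[OF refl])
      fix h assume h: "h \<in> ?I"
      have "p (?\<sigma> h) = p h"
        using drawn_tuple_prob_repivot[of M L w g h i] h i2 assms(1,3,10) L.is_group
        by (simp add: p_def carrier one)
      moreover have "W 1 (?\<sigma> h) = W i h"
        unfolding W_def F_def L_def
        by (rule expectation_position_weight_repivot[OF assms(4) refl assms(13) X assms(5) T k h i2])
      ultimately show "p (?\<sigma> h) * W 1 (?\<sigma> h) = p h * W i h"
        by simp
    qed
    finally show ?thesis .
  qed simp
  have total: "(\<Sum>i\<in>{1..w}. W i h) = real w * \<alpha>" if h: "h \<in> ?I" for h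
  proof -
    have "integrable M (\<lambda>\<omega>. F i h (X \<omega>))" if "i \<in> {1..w}" for i
      using measurable_compose[OF X F[OF h that]] bound
      by (intro integrable_const_bound[where B = "1 + real w * \<bar>\<alpha>\<bar> + real w"]) auto
    then have "(\<Sum>i\<in>{1..w}. W i h) = expectation (\<lambda>\<omega>. \<Sum>i\<in>{1..w}. F i h (X \<omega>))"
      unfolding W_def by (rule Bochner_Integration.integral_sum[symmetric])
    also have "\<dots> = real w * \<alpha>"
      unfolding F_def sum_position_weight[OF k] by (simp add: prob_space)
    finally show ?thesis .
  qed
  \<comment> \<open>The conditioning formula for the constant function 1.\<close>
  have "(\<Sum>h\<in>?I. p h) = 1"
    using expectation_indep_draw(2)[OF indep finI, of "\<lambda>_ _. 1" 1] by (simp add: p_def prob_space)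
  \<comment> \<open>Write \<open>w\<close> copies of the same sum, pivot the copy with index
    \<open>i\<close> at position \<open>i\<close>, and exchange the sums so that
    \<open>total\<close> applies for each draw.\<close>
  have "real w * (\<Sum>h\<in>?I. p h * W 1 h) = (\<Sum>i\<in>{1..w}. \<Sum>h\<in>?I. p h * W 1 h)"
    by simp
  also have "\<dots> = (\<Sum>i\<in>{1..w}. \<Sum>h\<in>?I. p h * W i h)"
    by (intro sum.cong refl pivot)
  also have "\<dots> = (\<Sum>h\<in>?I. p h * (\<Sum>i\<in>{1..w}. W i h))"
    unfolding sum_distrib_left by (rule sum.swap)
  also have "\<dots> = (\<Sum>h\<in>?I. p h) * (real w * \<alpha>)"
    unfolding sum_distrib_right by (intro sum.cong refl) (simp only: total)
  also have "\<dots> = real w * \<alpha>"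
    using \<open>(\<Sum>h\<in>?I. p h) = 1\<close> by simp
  finally have "(\<Sum>h\<in>?I. p h * W 1 h) = \<alpha>"
    using \<open>w \<ge> 1\<close> by simp
  with int ex show ?thesis
    by simp
qed

end
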